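(* Let $X$ be an implicative-ortholattice. Then $X$ is an implicative-orthomodular lattice if and only if for all $x,y\in X$, $x\perp y$ implies $x\wedge_Q y^*=x$.
   Context: A BE algebra is an algebra $(X,\to,1)$ such that for all $x,y,z\in X$: $x\to x=1$; $x\to 1=1$; $1\to x=x$; $x\to(y\to z)=y\to(x\to z)$. It carries the relation $x\le y$ iff $x\to y=1$. It is bounded if there is $0\in X$ with $0\le x$ for all $x\in X$; then $x^*:=x\to 0$ (so $0=1^*$) and the algebra is written $(X,\to,{}^*,1)$. It is involutive if $x^{**}=x$ for all $x$, and implicative if $(x\to y)\to x=x$ for all $x,y$. An implicative-ortholattice is an implicative involutive (bounded) BE algebra. Put $x\wedge_Q y:=((x^*\to y^* )\to y^* )^*$. An implicative-orthomodular lattice is an implicative-ortholattice with $x\wedge_Q(y\to x)=x$ for all $x,y$. Orthogonality: $x\perp y$ iff $x^*=x\to y$. *)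

theory Defs
  imports "HOL-Algebra.Congruence"
begin

text \<open>
  The algebra's arrow is written \<open>\<leadsto>\<close>, because \<open>\<rightarrow>\<close> is taken by the
  function-set syntax, and the complement \<open>x\<^sup>*\<close> is written \<open>x\<^sup>\<star>\<close>.
\<close>

record 'a be_algebra = "'a partial_object" +
  imp :: "'a \<Rightarrow> 'a \<Rightarrow> 'a" (infixr "\<leadsto>\<index>" 75)
  be_one :: 'a ("\<one>\<index>")

text \<open>
  The order of a BE algebra need not be antisymmetric, so a least element need not be
  unique; the chosen \<open>0\<close> is therefore part of the structure of a bounded BE algebra.
\<close>

record 'a bounded_be_algebra = "'a be_algebra" +
  be_zero :: 'a ("\<zero>\<index>")

definition be_le :: "('a, 'm) be_algebra_scheme \<Rightarrow> 'a \<Rightarrow> 'a \<Rightarrow> bool" (infix "\<preceq>\<index>" 50)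
  where "x \<preceq>\<^bsub>X\<^esub> y \<longleftrightarrow> x \<leadsto>\<^bsub>X\<^esub> y = \<one>\<^bsub>X\<^esub>"

definition be_star :: "('a, 'm) bounded_be_algebra_scheme \<Rightarrow> 'a \<Rightarrow> 'a" ("_\<^sup>\<star>\<index>" [1000] 999)
  where "x\<^sup>\<star>\<^bsub>X\<^esub> = x \<leadsto>\<^bsub>X\<^esub> \<zero>\<^bsub>X\<^esub>"

definition q_meet :: "('a, 'm) bounded_be_algebra_scheme \<Rightarrow> 'a \<Rightarrow> 'a \<Rightarrow> 'a"
    (infixl "\<and>\<^sub>Q\<index>" 70)
  where "x \<and>\<^sub>Q\<^bsub>X\<^esub> y =
    ((x\<^sup>\<star>\<^bsub>X\<^esub> \<leadsto>\<^bsub>X\<^esub> y\<^sup>\<star>\<^bsub>X\<^esub>) \<leadsto>\<^bsub>X\<^esub> y\<^sup>\<star>\<^bsub>X\<^esub>)\<^sup>\<star>\<^bsub>X\<^esub>"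

definition be_orthogonal :: "('a, 'm) bounded_be_algebra_scheme \<Rightarrow> 'a \<Rightarrow> 'a \<Rightarrow> bool"
    (infix "\<bottom>\<index>" 50)
  where "x \<bottom>\<^bsub>X\<^esub> y \<longleftrightarrow> x\<^sup>\<star>\<^bsub>X\<^esub> = x \<leadsto>\<^bsub>X\<^esub> y"

locale BE_algebra =
  fixes X :: "('a, 'm) be_algebra_scheme" (structure)
  assumes imp_closed: "\<lbrakk>x \<in> carrier X; y \<in> carrier X\<rbrakk> \<Longrightarrow> x \<leadsto> y \<in> carrier X"
    and one_closed: "\<one> \<in> carrier X"
    and imp_refl: "x \<in> carrier X \<Longrightarrow> x \<leadsto> x = \<one>"
    and imp_one: "x \<in> carrier X \<Longrightarrow> x \<leadsto> \<one> = \<one>"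
    and one_imp: "x \<in> carrier X \<Longrightarrow> \<one> \<leadsto> x = x"
    and imp_exchange: "\<lbrakk>x \<in> carrier X; y \<in> carrier X; z \<in> carrier X\<rbrakk> \<Longrightarrow>
      x \<leadsto> (y \<leadsto> z) = y \<leadsto> (x \<leadsto> z)"

locale bounded_BE_algebra = BE_algebra X
  for X :: "('a, 'm) bounded_be_algebra_scheme" (structure) +
  assumes zero_closed: "\<zero> \<in> carrier X"
    and zero_le: "x \<in> carrier X \<Longrightarrow> \<zero> \<preceq> x"

locale involutive_BE_algebra = bounded_BE_algebra +
  assumes star_star: "x \<in> carrier X \<Longrightarrow> (x\<^sup>\<star>)\<^sup>\<star> = x"

locale implicative_BE_algebra = BE_algebra +
  assumes implicative: "\<lbrakk>x \<in> carrier X; y \<in> carrier X\<rbrakk> \<Longrightarrow> (x \<leadsto> y) \<leadsto> x = x"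

locale implicative_ortholattice =
  involutive_BE_algebra X + implicative_BE_algebra X
  for X :: "('a, 'm) bounded_be_algebra_scheme" (structure)

locale implicative_orthomodular_lattice = implicative_ortholattice +
  assumes orthomodular:
    "\<lbrakk>x \<in> carrier X; y \<in> carrier X\<rbrakk> \<Longrightarrow> x \<and>\<^sub>Q (y \<leadsto> x) = x"

end

theory Submission
  imports Defs
begin

text \<open>
  Reading \<open>x \<leadsto> y\<close> as the join \<open>x\<^sup>\<star> \<or> y\<close>, \<open>x \<bottom> y\<close> says that \<open>y\<close> lies below \<open>x\<^sup>\<star>\<close> in the
  lattice order, which is in general stronger than \<open>\<preceq>\<close>. The orthomodular
  law is about pairs \<open>x\<close>, \<open>z \<leadsto> x\<close>, and the other condition is about pairs \<open>x\<close>, \<open>y\<^sup>\<star>\<close> with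
  \<open>x \<bottom> y\<close>. These are the same pairs. If \<open>x \<bottom> y\<close> then, since orthogonality is symmetric
  (\<open>orthogonal_sym\<close>), \<open>y\<^sup>\<star> = y \<leadsto> x\<close>, which has the form \<open>z \<leadsto> x\<close>. Conversely \<open>z \<leadsto> x\<close> is
  \<open>y\<^sup>\<star>\<close> for \<open>y = (z \<leadsto> x)\<^sup>\<star>\<close>, and this \<open>y\<close> is orthogonal to \<open>x\<close> (\<open>orthogonal_star_imp\<close>).
  Both lemmas rest on implicativity and contraposition.
\<close>

context involutive_BE_algebra
begin

lemma star_closed: "x \<in> carrier X \<Longrightarrow> x\<^sup>\<star> \<in> carrier X"
  by (simp add: be_star_def imp_closed zero_closed)

lemma imp_star_swap:
  assumes "x \<in> carrier X" "y \<in> carrier X"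
  shows "x \<leadsto> y\<^sup>\<star> = y \<leadsto> x\<^sup>\<star>"
  unfolding be_star_def using assms by (intro imp_exchange zero_closed)

lemma contraposition:
  assumes "x \<in> carrier X" "y \<in> carrier X"
  shows "y\<^sup>\<star> \<leadsto> x\<^sup>\<star> = x \<leadsto> y"
  using imp_star_swap[of x "y\<^sup>\<star>"] assms by (simp add: star_closed star_star)

end

context implicative_ortholattice
begin

text \<open>
  Contraposition turns \<open>x\<^sup>\<star> = x \<leadsto> y\<close> into \<open>x\<^sup>\<star> = y\<^sup>\<star> \<leadsto> x\<^sup>\<star>\<close>, and then \<open>x\<^sup>\<star> \<leadsto> y\<^sup>\<star>\<close> becomes the
  left side of an instance of the implicative law.
\<close>

lemma orthogonal_sym:
  assumes "x \<in> carrier X" "y \<in> carrier X" "x \<bottom> y"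
  shows "y \<bottom> x"
proof -
  have "y\<^sup>\<star> \<leadsto> x\<^sup>\<star> = x\<^sup>\<star>"
    unfolding contraposition[OF assms(1,2)] using assms(3) by (simp only: be_orthogonal_def)
  then have "x\<^sup>\<star> \<leadsto> y\<^sup>\<star> = y\<^sup>\<star>"
    using implicative[OF star_closed[OF assms(2)] star_closed[OF assms(1)]] by (simp only:)
  then show ?thesis
    by (simp only: be_orthogonal_def contraposition[OF assms(2,1)])
qed

text \<open>
  The case \<open>y = \<zero>\<close> of the implicative law is \<open>x\<^sup>\<star> \<leadsto> x = x\<close>, and exchange carries it under
  the premise \<open>z\<close>.
\<close>

lemma orthogonal_star_imp:
  assumes "x \<in> carrier X" "z \<in> carrier X"
  shows "(z \<leadsto> x)\<^sup>\<star> \<bottom> x"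
proof -
  have zx: "z \<leadsto> x \<in> carrier X"
    using assms by (simp add: imp_closed)
  have "x\<^sup>\<star> \<leadsto> x = x"
    using implicative[of x \<zero>] assms by (simp add: be_star_def zero_closed)
  then have "x\<^sup>\<star> \<leadsto> (z \<leadsto> x) = z \<leadsto> x"
    using imp_exchange[OF star_closed[OF assms(1)] assms(2,1)] by (simp only:)
  moreover have "(z \<leadsto> x)\<^sup>\<star> \<leadsto> x = x\<^sup>\<star> \<leadsto> (z \<leadsto> x)"
    using contraposition[of "(z \<leadsto> x)\<^sup>\<star>" x] assms zx by (simp add: star_closed star_star)
  ultimately show ?thesis
    using zx by (simp add: be_orthogonal_def star_star)
qed

end

theorem proposition3p6:
  fixes X :: "('a, 'm) bounded_be_algebra_scheme" (structure)
  assumes "implicative_ortholattice X"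
  shows "implicative_orthomodular_lattice X \<longleftrightarrow>
    (\<forall>x\<in>carrier X. \<forall>y\<in>carrier X. x \<bottom> y \<longrightarrow> x \<and>\<^sub>Q y\<^sup>\<star> = x)"
proof -
  interpret implicative_ortholattice X by fact
  show ?thesis
  proof
    assume "implicative_orthomodular_lattice X"
    then interpret implicative_orthomodular_lattice X .
    show "\<forall>x\<in>carrier X. \<forall>y\<in>carrier X. x \<bottom> y \<longrightarrow> x \<and>\<^sub>Q y\<^sup>\<star> = x"
    proof (intro ballI impI)
      fix x y assume xy: "x \<in> carrier X" "y \<in> carrier X" "x \<bottom> y"
      then have "y\<^sup>\<star> = y \<leadsto> x"
        using orthogonal_sym[of x y] by (simp only: be_orthogonal_def)
      then show "x \<and>\<^sub>Q y\<^sup>\<star> = x"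
        using orthomodular[of x y] xy(1,2) by simp
    qed
  next
    assume meet: "\<forall>x\<in>carrier X. \<forall>y\<in>carrier X. x \<bottom> y \<longrightarrow> x \<and>\<^sub>Q y\<^sup>\<star> = x"
    show "implicative_orthomodular_lattice X"
    proof
      fix x z assume xz: "x \<in> carrier X" "z \<in> carrier X"
      then have zx: "z \<leadsto> x \<in> carrier X"
        by (simp add: imp_closed)
      have "x \<bottom> (z \<leadsto> x)\<^sup>\<star>"
        by (rule orthogonal_sym[OF star_closed[OF zx] xz(1) orthogonal_star_imp[OF xz]])
      then have "x \<and>\<^sub>Q ((z \<leadsto> x)\<^sup>\<star>)\<^sup>\<star> = x"
        using meet xz zx by (simp add: star_closed)
      then show "x \<and>\<^sub>Q (z \<leadsto> x) = x"
        using zx by (simp add: star_star)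
    qed
  qed
qed

end
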